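(* Let $\Omega\subset\mathbb{H}$ be a symmetric slice domain, let $I_0,J_0\in\mathbb{S}$ be linearly independent, and let $f,h:\Omega\rightarrow \mathbb{H}$ be two slice regular functions, neither of which is slice preserving, such that $f=f_{0}+f_{1}I_{0}$ is $\mathbb{C}_{I_{0}}$-preserving and $h=h_{0}+h_{1}J_{0}$ is $\mathbb{C}_{J_{0}}$-preserving, with $f_{0},f_{1},h_{0},h_{1}$ slice preserving functions. Let $K_0\in\mathbb{S}$. Then $f*h$ is $\mathbb{C}_{K_{0}}$-preserving if and only if there exist $a, b \in\mathbb{R}$, $\varepsilon\in\mathbb{R}\setminus\{0\}$ such that $K_0=a I_0+ b J_0+\varepsilon\, I_0\wedge J_0$, $$f=f_1\left(\frac{b}{\varepsilon} +I_0\right)\quad\text{and}\quad h=h_1\left(\frac{a}{\varepsilon} +J_0\right).$$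
   Context: $\mathbb{H}$ is the algebra of quaternions with standard basis $1,i,j,k$, $\mathrm{Im}\,\mathbb{H}=\mathrm{Span}_{\mathbb{R}}(i,j,k)\simeq\mathbb{R}^3$ with vector (cross) product $\wedge$, $\mathbb{S}=\{q\in\mathbb{H}: q^2=-1\}$, and $\mathbb{C}_I=\mathrm{Span}_{\mathbb{R}}(1,I)$ for $I\in\mathbb{S}$. A symmetric slice domain $\Omega\subset\mathbb{H}$ is a domain (connected open set) such that $\Omega\cap\mathbb{R}\neq\emptyset$ and, whenever $\alpha+I\beta\in\Omega$ ($\alpha,\beta\in\mathbb{R}$, $I\in\mathbb{S}$), also $\alpha+J\beta\in\Omega$ for all $J\in\mathbb{S}$. A function $f:\Omega\to\mathbb{H}$ is slice regular if for every $J\in\mathbb{S}$ the restriction $f_J$ of $f$ to $\Omega\cap\mathbb{C}_J$ is holomorphic: $\frac12\left(\frac{\partial}{\partial\alpha}+J\frac{\partial}{\partial\beta}\right)f_J(\alpha+J\beta)\equiv0$. A slice regular $f$ is slice preserving if $f(\Omega\cap\mathbb{C}_I)\subset\mathbb{C}_I$ for all $I\in\mathbb{S}$, and $\mathbb{C}_J$-preserving if $f(\Omega\cap\mathbb{C}_J)\subset\mathbb{C}_J$. Known facts: every slice regular $f$ on $\Omega$ is written uniquely as $f=\varphi_0+\varphi_1i+\varphi_2j+\varphi_3k$ with $\varphi_0,\dots,\varphi_3$ slice preserving, and every $\mathbb{C}_J$-preserving $f$ uniquely as $f=f_0+f_1J$ with $f_0,f_1$ slice preserving. The $*$-product of $\varphi_0+\varphi_1i+\varphi_2j+\varphi_3k$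 and $\psi_0+\psi_1i+\psi_2j+\psi_3k$ is $\varphi_0\psi_0-\varphi_1\psi_1-\varphi_2\psi_2-\varphi_3\psi_3+\varphi_0(\psi_1i+\psi_2j+\psi_3k)+\psi_0(\varphi_1i+\varphi_2j+\varphi_3k)+(\varphi_2\psi_3-\varphi_3\psi_2)i+(\varphi_3\psi_1-\varphi_1\psi_3)j+(\varphi_1\psi_2-\varphi_2\psi_1)k$ (pointwise products). *)

theory Defs
  imports "HOL-Analysis.Analysis"
begin

section \<open>Quaternions\<close>

text \<open>The quaternion \<open>a + b i + c j + d k\<close> is \<open>Quat a b c d\<close>.\<close>

codatatype quat = Quat (QRe: real) (QI: real) (QJ: real) (QK: real)

lemma quat_eqI [intro?]:
  "QRe x = QRe y \<Longrightarrow> QI x = QI y \<Longrightarrow> QJ x = QJ y \<Longrightarrow> QK x = QK y \<Longrightarrow> x = y"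
  by (rule quat.expand) simp

lemma quat_eq_iff:
  "x = y \<longleftrightarrow> QRe x = QRe y \<and> QI x = QI y \<and> QJ x = QJ y \<and> QK x = QK y"
  by (auto intro: quat_eqI)

instantiation quat :: ab_group_add
begin

primcorec zero_quat where
  "QRe 0 = 0" | "QI 0 = 0" | "QJ 0 = 0" | "QK 0 = 0"

primcorec plus_quat where
  "QRe (x + y) = QRe x + QRe y"
| "QI (x + y) = QI x + QI y"
| "QJ (x + y) = QJ x + QJ y"
| "QK (x + y) = QK x + QK y"

primcorec uminus_quat where
  "QRe (- x) = - QRe x" | "QI (- x) = - QI x" | "QJ (- x) = - QJ x" | "QK (- x) = - QK x"

primcorec minus_quat where
  "QRe (x - y) = QRe x - QRe y"
| "QI (x - y) = QI x - QI y"
| "QJ (x - y) = QJ x - QJ y"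
| "QK (x - y) = QK x - QK y"

instance
  by standard (simp_all add: quat_eq_iff)

end

instantiation quat :: ring_1
begin

primcorec one_quat where
  "QRe 1 = 1" | "QI 1 = 0" | "QJ 1 = 0" | "QK 1 = 0"

primcorec times_quat where
  "QRe (x * y) = QRe x * QRe y - QI x * QI y - QJ x * QJ y - QK x * QK y"
| "QI (x * y) = QRe x * QI y + QI x * QRe y + QJ x * QK y - QK x * QJ y"
| "QJ (x * y) = QRe x * QJ y - QI x * QK y + QJ x * QRe y + QK x * QI y"
| "QK (x * y) = QRe x * QK y + QI x * QJ y - QJ x * QI y + QK x * QRe y"

instance
  by standard (simp_all add: quat_eq_iff algebra_simps)

end

instantiation quat :: real_algebra_1
begin

primcorec scaleR_quat where
  "QRe (scaleR r x) = r * QRe x"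
| "QI (scaleR r x) = r * QI x"
| "QJ (scaleR r x) = r * QJ x"
| "QK (scaleR r x) = r * QK x"

instance
  by standard (simp_all add: quat_eq_iff algebra_simps)

end

instantiation quat :: division_ring
begin

primcorec inverse_quat where
  "QRe (inverse x) = QRe x / ((QRe x)\<^sup>2 + (QI x)\<^sup>2 + (QJ x)\<^sup>2 + (QK x)\<^sup>2)"
| "QI (inverse x) = - QI x / ((QRe x)\<^sup>2 + (QI x)\<^sup>2 + (QJ x)\<^sup>2 + (QK x)\<^sup>2)"
| "QJ (inverse x) = - QJ x / ((QRe x)\<^sup>2 + (QI x)\<^sup>2 + (QJ x)\<^sup>2 + (QK x)\<^sup>2)"
| "QK (inverse x) = - QK x / ((QRe x)\<^sup>2 + (QI x)\<^sup>2 + (QJ x)\<^sup>2 + (QK x)\<^sup>2)"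

definition "x div y = x * inverse y" for x y :: quat

instance
proof
  fix x y :: quat
  show "x div y = x * inverse y"
    by (simp add: divide_quat_def)
  show "inverse (0::quat) = 0"
    by (simp add: quat_eq_iff)
  assume "x \<noteq> 0"
  define n where "n = (QRe x)\<^sup>2 + (QI x)\<^sup>2 + (QJ x)\<^sup>2 + (QK x)\<^sup>2"
  have "n \<noteq> 0"
  proof
    assume "n = 0"
    then have "(QRe x)\<^sup>2 = 0" "(QI x)\<^sup>2 = 0" "(QJ x)\<^sup>2 = 0" "(QK x)\<^sup>2 = 0"
      unfolding n_def
      using zero_le_power2[of "QRe x"] zero_le_power2[of "QI x"]
        zero_le_power2[of "QJ x"] zero_le_power2[of "QK x"] by linarith+
    with \<open>x \<noteq> 0\<close> show False
      by (simp add: quat_eq_iff)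
  qed
  define c where "c = Quat (QRe x) (- QI x) (- QJ x) (- QK x)"
  have inv: "inverse x = (1 / n) *\<^sub>R c"
    by (simp add: quat_eq_iff c_def n_def)
  have "c * x = n *\<^sub>R 1" "x * c = n *\<^sub>R 1"
    by (simp_all add: quat_eq_iff c_def n_def power2_eq_square)
  then show "inverse x * x = 1" "x * inverse x = 1"
    using \<open>n \<noteq> 0\<close> by (simp_all add: inv)
qed

end

instantiation quat :: real_normed_div_algebra
begin

definition norm_quat_def:
  "norm q = sqrt ((QRe q)\<^sup>2 + (QI q)\<^sup>2 + (QJ q)\<^sup>2 + (QK q)\<^sup>2)" for q :: quat

definition sgn_quat_def: "sgn q = q /\<^sub>R norm q" for q :: quat

definition dist_quat_def: "dist p q = norm (p - q)" for p q :: quat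

definition uniformity_quat_def:
  "(uniformity :: (quat \<times> quat) filter) = (INF e\<in>{0 <..}. principal {(x, y). dist x y < e})"

definition open_quat_def:
  "open (U :: quat set) \<longleftrightarrow> (\<forall>x\<in>U. eventually (\<lambda>(x', y). x' = x \<longrightarrow> y \<in> U) uniformity)"

lemma norm_quat_eq_norm_prod:
  "norm q = norm ((QRe q, QI q), (QJ q, QK q))" for q :: quat
  by (simp add: norm_quat_def norm_prod_def)

instance
proof
  fix r :: real and x y :: quat and U :: "quat set"
  show "norm x = 0 \<longleftrightarrow> x = 0"
    unfolding norm_quat_eq_norm_prod by (simp add: quat_eq_iff zero_prod_def)
  show "norm (x + y) \<le> norm x + norm y"
    unfolding norm_quat_eq_norm_prod
    using norm_triangle_ineq[of "((QRe x, QI x), (QJ x, QK x))" "((QRe y, QI y), (QJ y, QK y))"]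
    by simp
  show "norm (scaleR r x) = \<bar>r\<bar> * norm x"
    unfolding norm_quat_eq_norm_prod
    using norm_scaleR[of r "((QRe x, QI x), (QJ x, QK x))"] by simp
  show "norm (x * y) = norm x * norm y"
    unfolding norm_quat_def real_sqrt_mult[symmetric]
    by (rule arg_cong[where f = sqrt]) (simp add: power2_eq_square algebra_simps)
qed (rule sgn_quat_def dist_quat_def open_quat_def uniformity_quat_def)+

end

primcorec quat_i :: quat where
  "QRe quat_i = 0" | "QI quat_i = 1" | "QJ quat_i = 0" | "QK quat_i = 0"

primcorec quat_j :: quat where
  "QRe quat_j = 0" | "QI quat_j = 0" | "QJ quat_j = 1" | "QK quat_j = 0"

primcorec quat_k :: quat where
  "QRe quat_k = 0" | "QI quat_k = 0" | "QJ quat_k = 0" | "QK quat_k = 1"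

lemma quat_ijk:
  "quat_i * quat_i = -1" "quat_j * quat_j = -1" "quat_k * quat_k = -1"
  "quat_i * quat_j = quat_k" "quat_j * quat_k = quat_i" "quat_k * quat_i = quat_j"
  "quat_j * quat_i = - quat_k" "quat_k * quat_j = - quat_i" "quat_i * quat_k = - quat_j"
  by (simp_all add: quat_eq_iff)

lemma quat_sel_of_real [simp]:
  "QRe (of_real r) = r" "QI (of_real r) = 0" "QJ (of_real r) = 0" "QK (of_real r) = 0"
  by (simp_all add: of_real_def)

lemma quat_expand:
  "q = of_real (QRe q) + of_real (QI q) * quat_i + of_real (QJ q) * quat_j + of_real (QK q) * quat_k"
  by (simp add: quat_eq_iff)

instantiation quat :: real_inner
begin

definition inner_quat_def:
  "inner x y = QRe x * QRe y + QI x * QI y + QJ x * QJ y + QK x * QK y" for x y :: quat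

instance
proof
  fix x y z :: quat and r :: real
  show "inner x y = inner y x"
    by (simp add: inner_quat_def mult.commute)
  show "inner (x + y) z = inner x z + inner y z"
    by (simp add: inner_quat_def algebra_simps)
  show "inner (scaleR r x) y = r * inner x y"
    by (simp add: inner_quat_def algebra_simps)
  show "0 \<le> inner x x"
    by (simp add: inner_quat_def)
  show "norm x = sqrt (inner x x)"
    by (simp add: norm_quat_def inner_quat_def power2_eq_square)
  then have "inner x x = (norm x)\<^sup>2"
    using \<open>0 \<le> inner x x\<close> by simp
  then show "inner x x = 0 \<longleftrightarrow> x = 0"
    by simp
qed

end

instantiation quat :: euclidean_space
begin

definition Basis_quat_def: "Basis = {1, quat_i, quat_j, quat_k}"

instance
proof
  show "Basis \<noteq> ({} :: quat set)" and "finite (Basis :: quat set)"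
    by (simp_all add: Basis_quat_def)
  show "inner u v = (if u = v then 1 else 0)" if "u \<in> Basis" "v \<in> Basis" for u v :: quat
    using that unfolding Basis_quat_def
    by (elim insertE emptyE) (simp_all add: inner_quat_def quat_eq_iff)
  show "(\<forall>u\<in>Basis. inner x u = 0) \<longleftrightarrow> x = 0" for x :: quat
    unfolding Basis_quat_def by (simp add: inner_quat_def) (simp add: quat_eq_iff)
qed

end

text \<open>The vector product on \<open>Im \<H>\<close>, through the identification of \<open>i, j, k\<close> with the standard
  basis of \<open>\<real>\<^sup>3\<close>.  It is only meant for purely imaginary arguments; real parts are ignored.\<close>

definition quat_im :: "quat \<Rightarrow> real^3" where
  "quat_im q = vector [QI q, QJ q, QK q]"

definition quat_of_im :: "real^3 \<Rightarrow> quat" where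
  "quat_of_im v = Quat 0 (v $ 1) (v $ 2) (v $ 3)"

definition quat_wedge :: "quat \<Rightarrow> quat \<Rightarrow> quat" where
  "quat_wedge p q = quat_of_im (cross3 (quat_im p) (quat_im q))"


section \<open>Slice regular functions\<close>

definition imag_units :: "quat set" where
  "imag_units = {q. q\<^sup>2 = -1}"

definition slice_plane :: "quat \<Rightarrow> quat set" where
  "slice_plane I = span {1, I}"

definition symmetric_slice_domain :: "quat set \<Rightarrow> bool" where
  "symmetric_slice_domain \<Omega> \<longleftrightarrow>
     open \<Omega> \<and> connected \<Omega> \<and> \<Omega> \<inter> \<real> \<noteq> {} \<and>
     (\<forall>\<alpha> \<beta>. \<forall>I\<in>imag_units. of_real \<alpha> + I * of_real \<beta> \<in> \<Omega> \<longrightarrow>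
        (\<forall>J\<in>imag_units. of_real \<alpha> + J * of_real \<beta> \<in> \<Omega>))"

definition slice_point :: "quat \<Rightarrow> complex \<Rightarrow> quat" where
  "slice_point J z = of_real (Re z) + J * of_real (Im z)"

text \<open>Functions on \<open>\<Omega>\<close> are total functions whose values off \<open>\<Omega>\<close> are irrelevant.  The restriction
  of \<open>f\<close> to \<open>\<Omega> \<inter> \<complex>\<^sub>J\<close> is read in the coordinate \<open>z = \<alpha> + \<i>\<beta>\<close>, so that the partial derivatives
  with respect to \<open>\<alpha>\<close> and \<open>\<beta>\<close> are the values of the real differential \<open>D\<close> at \<open>1\<close> and \<open>\<i>\<close>.
  As in the definition of holomorphy, real differentiability at every point is part of the
  condition, next to the Cauchy-Riemann equation.\<close>

definition slice_regular :: "quat set \<Rightarrow> (quat \<Rightarrow> quat) \<Rightarrow> bool" where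
  "slice_regular \<Omega> f \<longleftrightarrow>
     (\<forall>J\<in>imag_units. \<forall>z. slice_point J z \<in> \<Omega> \<longrightarrow>
        (\<exists>D. ((\<lambda>w. f (slice_point J w)) has_derivative D) (at z) \<and>
             (1/2) *\<^sub>R (D 1 + J * D \<i>) = 0))"

definition plane_preserving :: "quat set \<Rightarrow> quat \<Rightarrow> (quat \<Rightarrow> quat) \<Rightarrow> bool" where
  "plane_preserving \<Omega> J f \<longleftrightarrow>
     slice_regular \<Omega> f \<and> f ` (\<Omega> \<inter> slice_plane J) \<subseteq> slice_plane J"

definition slice_preserving :: "quat set \<Rightarrow> (quat \<Rightarrow> quat) \<Rightarrow> bool" where
  "slice_preserving \<Omega> f \<longleftrightarrow>
     slice_regular \<Omega> f \<and> (\<forall>I\<in>imag_units. f ` (\<Omega> \<inter> slice_plane I) \<subseteq> slice_plane I)"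

definition ijk_decomposition ::
  "quat set \<Rightarrow> (quat \<Rightarrow> quat) \<Rightarrow>
   (quat \<Rightarrow> quat) \<times> (quat \<Rightarrow> quat) \<times> (quat \<Rightarrow> quat) \<times> (quat \<Rightarrow> quat) \<Rightarrow> bool" where
  "ijk_decomposition \<Omega> f = (\<lambda>(\<phi>0, \<phi>1, \<phi>2, \<phi>3).
     slice_preserving \<Omega> \<phi>0 \<and> slice_preserving \<Omega> \<phi>1 \<and>
     slice_preserving \<Omega> \<phi>2 \<and> slice_preserving \<Omega> \<phi>3 \<and>
     (\<forall>q\<in>\<Omega>. f q = \<phi>0 q + \<phi>1 q * quat_i + \<phi>2 q * quat_j + \<phi>3 q * quat_k))"

text \<open>For \<open>f\<close> slice regular on a symmetric slice domain \<open>\<Omega>\<close> the decomposition exists and is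
  unique on \<open>\<Omega>\<close>; the choice operator only fixes the irrelevant values off \<open>\<Omega>\<close>.\<close>

definition ijk_components ::
  "quat set \<Rightarrow> (quat \<Rightarrow> quat) \<Rightarrow>
   (quat \<Rightarrow> quat) \<times> (quat \<Rightarrow> quat) \<times> (quat \<Rightarrow> quat) \<times> (quat \<Rightarrow> quat)" where
  "ijk_components \<Omega> f = (SOME \<Phi>. ijk_decomposition \<Omega> f \<Phi>)"

definition star_product ::
  "quat set \<Rightarrow> (quat \<Rightarrow> quat) \<Rightarrow> (quat \<Rightarrow> quat) \<Rightarrow> quat \<Rightarrow> quat" where
  "star_product \<Omega> f g =
     (case ijk_components \<Omega> f of (\<phi>0, \<phi>1, \<phi>2, \<phi>3) \<Rightarrow>
      case ijk_components \<Omega> g of (\<psi>0, \<psi>1, \<psi>2, \<psi>3) \<Rightarrow>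
      (\<lambda>q. \<phi>0 q * \<psi>0 q - \<phi>1 q * \<psi>1 q - \<phi>2 q * \<psi>2 q - \<phi>3 q * \<psi>3 q
         + \<phi>0 q * (\<psi>1 q * quat_i + \<psi>2 q * quat_j + \<psi>3 q * quat_k)
         + \<psi>0 q * (\<phi>1 q * quat_i + \<phi>2 q * quat_j + \<phi>3 q * quat_k)
         + (\<phi>2 q * \<psi>3 q - \<phi>3 q * \<psi>2 q) * quat_i
         + (\<phi>3 q * \<psi>1 q - \<phi>1 q * \<psi>3 q) * quat_j
         + (\<phi>1 q * \<psi>2 q - \<phi>2 q * \<psi>1 q) * quat_k))"

end

theory Submission
  imports Defs "HOL-Complex_Analysis.Complex_Analysis"
begin

text \<open>A slice preserving function is the same thing as a single holomorphic function, its stem, on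
  the common planar domain of all slices.  In these terms
  \<open>f * h = (f\<^sub>0 h\<^sub>0 - \<langle>I\<^sub>0, J\<^sub>0\<rangle> f\<^sub>1 h\<^sub>1) + h\<^sub>0 f\<^sub>1 I\<^sub>0 + f\<^sub>0 h\<^sub>1 J\<^sub>0 + f\<^sub>1 h\<^sub>1 I\<^sub>0 \<and> J\<^sub>0\<close>.
  If it preserves \<open>\<complex>\<^sub>K\<close> with \<open>K = K\<^sub>0\<close>, then comparing a point of that slice with its conjugate
  shows that the real and the imaginary parts of the stems of \<open>(h\<^sub>0 f\<^sub>1, f\<^sub>0 h\<^sub>1, f\<^sub>1 h\<^sub>1)\<close> are
  multiples of the coordinates \<open>(a, b, \<epsilon>)\<close> of \<open>K\<^sub>0\<close> in the basis \<open>I\<^sub>0, J\<^sub>0, I\<^sub>0 \<and> J\<^sub>0\<close>.  Neither \<open>f\<^sub>1\<close>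
  nor \<open>h\<^sub>1\<close> vanishes identically, so the identity theorem gives \<open>\<epsilon> \<noteq> 0\<close> and allows us to cancel
  them from \<open>\<epsilon> h\<^sub>0 f\<^sub>1 = a f\<^sub>1 h\<^sub>1\<close> and \<open>\<epsilon> f\<^sub>0 h\<^sub>1 = b f\<^sub>1 h\<^sub>1\<close>.\<close>

section \<open>Slices of the quaternions\<close>

text \<open>The vector part of \<open>q * q\<close> is twice \<open>QRe q\<close> times the vector
  part of \<open>q\<close>. A nonzero real part would therefore leave a real number with square
  -1.\<close>

lemma imag_units_iff:
  "q \<in> imag_units \<longleftrightarrow> QRe q = 0 \<and> (QI q)\<^sup>2 + (QJ q)\<^sup>2 + (QK q)\<^sup>2 = 1"
proof
  assume "q \<in> imag_units"
  then have sq: "q * q = -1"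
    by (simp add: imag_units_def power2_eq_square)
  have re: "QRe q * QRe q - QI q * QI q - QJ q * QJ q - QK q * QK q = -1"
    and im: "QRe q * QI q = 0" "QRe q * QJ q = 0" "QRe q * QK q = 0"
    using sq by (auto simp: quat_eq_iff)
  have "QRe q = 0"
  proof (rule ccontr)
    assume "QRe q \<noteq> 0"
    then have "QRe q * QRe q = -1"
      using re im by simp
    then show False
      using zero_le_square[of "QRe q"] by linarith
  qed
  with re show "QRe q = 0 \<and> (QI q)\<^sup>2 + (QJ q)\<^sup>2 + (QK q)\<^sup>2 = 1"
    by (simp add: power2_eq_square)
next
  assume "QRe q = 0 \<and> (QI q)\<^sup>2 + (QJ q)\<^sup>2 + (QK q)\<^sup>2 = 1"
  then show "q \<in> imag_units"
    by (simp add: imag_units_def power2_eq_square quat_eq_iff)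
qed

lemma imag_units_square: "J \<in> imag_units \<Longrightarrow> J * J = -1"
  by (simp add: imag_units_def power2_eq_square)

lemma imag_units_uminus [simp]: "- J \<in> imag_units \<longleftrightarrow> J \<in> imag_units"
  by (simp add: imag_units_def)

lemma quat_i_imag_unit [simp]: "quat_i \<in> imag_units"
  by (simp add: imag_units_iff)

lemma quat_j_imag_unit [simp]: "quat_j \<in> imag_units"
  by (simp add: imag_units_iff)

lemma slice_point_add: "slice_point J (z + w) = slice_point J z + slice_point J w"
  by (simp add: slice_point_def algebra_simps)

lemma slice_point_diff: "slice_point J (z - w) = slice_point J z - slice_point J w"
  by (simp add: slice_point_def algebra_simps)

lemma slice_point_of_real [simp]: "slice_point J (of_real r) = of_real r"
  by (simp add: slice_point_def)

lemma slice_point_0 [simp]: "slice_point J 0 = 0"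
  by (simp add: slice_point_def)

lemma slice_point_scaleR: "slice_point J (r *\<^sub>R z) = r *\<^sub>R slice_point J z"
  by (simp add: slice_point_def quat_eq_iff algebra_simps)

lemma slice_point_uminus_unit: "slice_point (- J) z = slice_point J (cnj z)"
  by (simp add: slice_point_def)

lemma slice_point_mult:
  assumes "J \<in> imag_units"
  shows "slice_point J (z * w) = slice_point J z * slice_point J w"
proof -
  have "slice_point J z * slice_point J w =
      of_real (Re z * Re w) + J * of_real (Re z * Im w + Im z * Re w)
        + (J * J) * of_real (Im z * Im w)"
    by (simp add: slice_point_def quat_eq_iff algebra_simps)
  then show ?thesis
    unfolding imag_units_square[OF assms] by (simp add: slice_point_def algebra_simps)
qed

lemma slice_point_inj:
  assumes "J \<in> imag_units" "slice_point J z = slice_point J w"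
  shows "z = w"
proof -
  have J: "QRe J = 0" "(QI J)\<^sup>2 + (QJ J)\<^sup>2 + (QK J)\<^sup>2 = 1"
    using assms(1) by (auto simp: imag_units_iff)
  have e: "slice_point J (z - w) = 0"
    using assms(2) by (simp add: slice_point_diff)
  then have "Re (z - w) = 0" "QI J * Im (z - w) = 0" "QJ J * Im (z - w) = 0" "QK J * Im (z - w) = 0"
    using J(1) by (auto simp: slice_point_def quat_eq_iff)
  moreover have "\<not> (QI J = 0 \<and> QJ J = 0 \<and> QK J = 0)"
    using J(2) by auto
  ultimately show ?thesis
    by (auto simp: complex_eq_iff)
qed

lemma bounded_linear_slice_point: "bounded_linear (slice_point J)"
  by (intro linear_conv_bounded_linear[THEN iffD1] linearI)
     (simp_all add: slice_point_add slice_point_scaleR)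

lemma slice_plane_eq: "slice_plane J = range (slice_point J)"
proof (intro set_eqI iffI)
  fix q assume "q \<in> slice_plane J"
  then obtain s t where "q = s *\<^sub>R 1 + t *\<^sub>R J"
    unfolding slice_plane_def by (auto simp: span_insert algebra_simps)
  then have "q = slice_point J (Complex s t)"
    by (simp add: slice_point_def quat_eq_iff)
  then show "q \<in> range (slice_point J)" by blast
next
  fix q assume "q \<in> range (slice_point J)"
  then obtain z where "q = slice_point J z" by blast
  then have "q = Re z *\<^sub>R 1 + Im z *\<^sub>R J"
    by (simp add: slice_point_def quat_eq_iff)
  then show "q \<in> slice_plane J"
    unfolding slice_plane_def by (simp add: span_add span_base span_scale)
qed

section \<open>Linear algebra: conjugate points of a slice and the basis given by two units and
  their vector product\<close>

text \<open>The two hypotheses read \<open>?R + K * ?I\<close> and \<open>?R - K * ?I\<close>, so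
  half their sum is \<open>?R\<close>. Half their difference is \<open>K * ?I\<close>, and one more
  factor \<open>K\<close> on the left, under which \<open>S\<close> is stable, returns
  \<open>?I\<close> up to sign.\<close>

lemma slice_separation:
  assumes K: "K \<in> imag_units" and S: "subspace S" "\<And>x. x \<in> S \<Longrightarrow> K * x \<in> S"
    and "slice_point K a0 * v0 + slice_point K a1 * v1 + slice_point K a2 * v2 + slice_point K a3 * v3 \<in> S"
      (is "?X \<in> S")
    and "slice_point K (cnj a0) * v0 + slice_point K (cnj a1) * v1 + slice_point K (cnj a2) * v2
      + slice_point K (cnj a3) * v3 \<in> S" (is "?Y \<in> S")
  shows "Re a0 *\<^sub>R v0 + Re a1 *\<^sub>R v1 + Re a2 *\<^sub>R v2 + Re a3 *\<^sub>R v3 \<in> S \<and>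
    Im a0 *\<^sub>R v0 + Im a1 *\<^sub>R v1 + Im a2 *\<^sub>R v2 + Im a3 *\<^sub>R v3 \<in> S" (is "?R \<in> S \<and> ?I \<in> S")
proof
  have split: "slice_point K a * v = Re a *\<^sub>R v + K * (Im a *\<^sub>R v)"
    "slice_point K (cnj a) * v = Re a *\<^sub>R v - K * (Im a *\<^sub>R v)" for a v
    by (simp_all add: slice_point_def quat_eq_iff algebra_simps)
  have "?X = ?R + K * ?I" "?Y = ?R - K * ?I"
    unfolding split by (simp_all add: algebra_simps)
  then have X: "?R + K * ?I \<in> S" and Y: "?R - K * ?I \<in> S"
    using assms(4,5) by simp_all
  have "(1/2) *\<^sub>R ((?R + K * ?I) + (?R - K * ?I)) \<in> S"
    by (intro subspace_scale subspace_add X Y S)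
  then show "?R \<in> S" by (simp add: scaleR_add_right[symmetric] flip: scaleR_2)
  have "(-1/2) *\<^sub>R (K * ((?R + K * ?I) - (?R - K * ?I))) \<in> S"
    by (intro subspace_scale subspace_diff X Y S)
  moreover have "K * (K * x) = - x" for x
    using imag_units_square[OF K] by (simp flip: mult.assoc)
  then have "(-1/2) *\<^sub>R (K * ((R + K * x) - (R - K * x))) = x" for R x
    by (simp add: algebra_simps flip: scaleR_2)
  ultimately show "?I \<in> S" by simp
qed

lemma quat_wedge_sel:
  "QRe (quat_wedge p q) = 0"
  "QI (quat_wedge p q) = QJ p * QK q - QK p * QJ q"
  "QJ (quat_wedge p q) = QK p * QI q - QI p * QK q"
  "QK (quat_wedge p q) = QI p * QJ q - QJ p * QI q"
  by (simp_all add: quat_wedge_def quat_of_im_def quat_im_def cross3_def)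

lemma independent_pair_scaleR:
  fixes u v :: "'a :: real_vector"
  assumes "independent {u, v}" "u \<noteq> v" "x *\<^sub>R u + y *\<^sub>R v = 0"
  shows "x = 0" "y = 0"
proof -
  define c where "c w = (if w = u then x else y)" for w
  have "(\<Sum>w\<in>{u, v}. c w *\<^sub>R w) = 0"
    using assms by (simp add: c_def)
  then have "c u = 0" "c v = 0"
    using independentD[OF assms(1), of "{u, v}" c] by auto
  then show "x = 0" "y = 0"
    using assms(2) by (auto simp: c_def)
qed

text \<open>The vector product is orthogonal to \<open>I\<close> and \<open>J\<close>, so pairing
  the relation with it isolates \<open>w\<close>. Independence of \<open>I\<close> and
  \<open>J\<close> makes the vector product nonzero and then settles \<open>x\<close> and
  \<open>y\<close>.\<close>

lemma independent_wedge_scaleR: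
  assumes I: "I \<in> imag_units" and J: "J \<in> imag_units" and ind: "independent {I, J}" "I \<noteq> J"
    and eq: "x *\<^sub>R I + y *\<^sub>R J + w *\<^sub>R quat_wedge I J = 0"
  shows "x = 0 \<and> y = 0 \<and> w = 0"
proof -
  let ?N = "quat_wedge I J"
  have IJ: "QRe I = 0" "QRe J = 0" "(QI I)\<^sup>2 + (QJ I)\<^sup>2 + (QK I)\<^sup>2 = 1" "(QI J)\<^sup>2 + (QJ J)\<^sup>2 + (QK J)\<^sup>2 = 1"
    using I J by (auto simp: imag_units_iff)
  \<comment> \<open>Lagrange's identity for two vectors of length 1.\<close>
  have n: "inner ?N ?N = 1 - (inner I J)\<^sup>2"
  proof -
    have "inner ?N ?N + (inner I J)\<^sup>2
        = ((QI I)\<^sup>2 + (QJ I)\<^sup>2 + (QK I)\<^sup>2) * ((QI J)\<^sup>2 + (QJ J)\<^sup>2 + (QK J)\<^sup>2)"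
      using IJ(1,2) by (simp add: inner_quat_def quat_wedge_sel power2_eq_square algebra_simps)
    then show ?thesis by (simp add: IJ)
  qed
  have u: "inner I I = 1" "inner J J = 1"
    using IJ by (simp_all add: inner_quat_def power2_eq_square)
  \<comment> \<open>Up to sign this vector is the component of \<open>J\<close> orthogonal to
    \<open>I\<close>. It is nonzero by independence, and its squared length is that of
    \<open>?N\<close>.\<close>
  have "inner (inner I J *\<^sub>R I - J) (inner I J *\<^sub>R I - J) = 1 - (inner I J)\<^sup>2"
    by (simp add: inner_diff_left inner_diff_right u inner_commute[of J I] power2_eq_square)
  moreover have "inner I J *\<^sub>R I - J \<noteq> 0"
    using independent_pair_scaleR(2)[OF ind, of "inner I J" "-1"] by auto
  ultimately have N: "inner ?N ?N \<noteq> 0"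
    using n by (metis inner_eq_zero_iff)
  have "inner I ?N = 0" "inner J ?N = 0"
    using IJ(1,2) by (simp_all add: inner_quat_def quat_wedge_sel algebra_simps)
  then have "w * inner ?N ?N = inner (x *\<^sub>R I + y *\<^sub>R J + w *\<^sub>R ?N) ?N"
    by (simp add: inner_add_left)
  then have "w = 0" using N by (simp add: eq)
  with eq independent_pair_scaleR[OF ind] show ?thesis by simp
qed

lemma slice_plane_imaginary:
  assumes "K \<in> imag_units" "q \<in> slice_plane K" "QRe q = 0"
  obtains t where "q = t *\<^sub>R K"
proof -
  obtain z where z: "q = slice_point K z" using assms(2) by (auto simp: slice_plane_eq)
  then have "Re z = 0" using assms by (simp add: slice_point_def imag_units_iff)
  then have "q = Im z *\<^sub>R K" by (simp add: z slice_point_def quat_eq_iff)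
  then show ?thesis using that by blast
qed

section \<open>From a quaternion back to its planar coordinate\<close>

text \<open>The pairs (\<open>J\<close>, \<open>z\<close>) and (\<open>- J\<close>,
  \<open>cnj z\<close>) describe the same quaternion. Taking the representative in the closed upper
  half plane removes the ambiguity and gives a map that is continuous across the real axis
  too.\<close>

definition slice_coord :: "quat \<Rightarrow> complex" where
  "slice_coord q = Complex (QRe q) (sqrt ((QI q)\<^sup>2 + (QJ q)\<^sup>2 + (QK q)\<^sup>2))"

lemma slice_coord_slice_point:
  assumes "J \<in> imag_units"
  shows "slice_coord (slice_point J z) = Complex (Re z) \<bar>Im z\<bar>"
proof -
  have J: "QRe J = 0" "(QI J)\<^sup>2 + (QJ J)\<^sup>2 + (QK J)\<^sup>2 = 1"
    using assms by (auto simp: imag_units_iff)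
  have "(QI J * Im z)\<^sup>2 + (QJ J * Im z)\<^sup>2 + (QK J * Im z)\<^sup>2
      = ((QI J)\<^sup>2 + (QJ J)\<^sup>2 + (QK J)\<^sup>2) * (Im z)\<^sup>2"
    by (simp add: power_mult_distrib algebra_simps)
  then show ?thesis
    using J by (simp add: slice_coord_def slice_point_def)
qed

text \<open>The unit is the normalized vector part of \<open>q\<close>. If \<open>q\<close> is real,
  any unit works and \<open>quat_i\<close> is taken.\<close>

lemma slice_point_slice_coord:
  obtains J where "J \<in> imag_units" "slice_point J (slice_coord q) = q"
proof (cases "Im (slice_coord q) = 0")
  case True
  then have "(QI q)\<^sup>2 + (QJ q)\<^sup>2 + (QK q)\<^sup>2 = 0"
    by (simp add: slice_coord_def)
  then have "(QI q)\<^sup>2 = 0" "(QJ q)\<^sup>2 = 0" "(QK q)\<^sup>2 = 0"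
    using zero_le_power2[of "QI q"] zero_le_power2[of "QJ q"] zero_le_power2[of "QK q"]
    by linarith+
  then have "slice_point quat_i (slice_coord q) = q"
    by (simp add: slice_coord_def slice_point_def quat_eq_iff)
  then show ?thesis
    using that quat_i_imag_unit by blast
next
  case False
  define s where "s = Im (slice_coord q)"
  define J where "J = Quat 0 (QI q / s) (QJ q / s) (QK q / s)"
  have s: "s \<noteq> 0" "s\<^sup>2 = (QI q)\<^sup>2 + (QJ q)\<^sup>2 + (QK q)\<^sup>2"
    using False by (simp_all add: s_def slice_coord_def)
  have "J \<in> imag_units"
    using s by (simp add: imag_units_iff J_def power_divide add_divide_distrib[symmetric] flip: s(2))
  moreover have "slice_point J (slice_coord q) = q"
    using s(1) by (simp add: slice_point_def quat_eq_iff J_def flip: s_def)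
      (simp add: slice_coord_def)
  ultimately show ?thesis
    using that by blast
qed

lemma bounded_linear_quat_sel:
  "bounded_linear QRe" "bounded_linear QI" "bounded_linear QJ" "bounded_linear QK"
  by (auto intro!: linear_conv_bounded_linear[THEN iffD1] linearI)

lemma continuous_on_slice_coord: "continuous_on A slice_coord"
proof -
  have *: "slice_coord = (\<lambda>q. of_real (QRe q)
      + \<i> * of_real (sqrt ((QI q)\<^sup>2 + (QJ q)\<^sup>2 + (QK q)\<^sup>2)))"
    by (simp add: fun_eq_iff slice_coord_def complex_eq_iff)
  show ?thesis
    unfolding * by (intro continuous_intros bounded_linear_quat_sel[THEN bounded_linear.continuous_on])
qed


section \<open>Stem functions\<close>

text \<open>On a symmetric slice domain every unit gives the same set; \<open>quat_i\<close> is only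
  a representative.\<close>

definition planar_domain :: "quat set \<Rightarrow> complex set" where
  "planar_domain \<Omega> = {z. slice_point quat_i z \<in> \<Omega>}"

text \<open>One \<open>g\<close> has to serve every unit. Since \<open>J\<close> and
  \<open>- J\<close> both occur, compatibility of \<open>g\<close> with conjugation follows and is
  not demanded separately.\<close>

definition is_stem :: "quat set \<Rightarrow> (quat \<Rightarrow> quat) \<Rightarrow> (complex \<Rightarrow> complex) \<Rightarrow> bool" where
  "is_stem \<Omega> f g \<longleftrightarrow> g holomorphic_on planar_domain \<Omega> \<and>
     (\<forall>J\<in>imag_units. \<forall>z\<in>planar_domain \<Omega>. f (slice_point J z) = slice_point J (g z))"

lemma is_stemD:
  assumes "is_stem \<Omega> f g"
  shows "g holomorphic_on planar_domain \<Omega>"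
    and "\<And>J z. \<lbrakk>J \<in> imag_units; z \<in> planar_domain \<Omega>\<rbrakk> \<Longrightarrow> f (slice_point J z) = slice_point J (g z)"
  using assms by (auto simp: is_stem_def)

section \<open>Identity theorems and the Cauchy-Riemann equation for stems\<close>

text \<open>Holomorphic functions on a connected open set have no zero divisors: \<open>h\<close>
  vanishes on the nonempty open set where \<open>g\<close> does not, hence everywhere by analytic
  continuation.\<close>

lemma identity_theorem_mult:
  assumes "open U" "connected U" "g holomorphic_on U" "h holomorphic_on U"
    and prod: "\<And>z. z \<in> U \<Longrightarrow> g z * h z = 0" and "w \<in> U" "g w \<noteq> 0" and "z \<in> U"
  shows "h z = 0"
proof -
  define V where "V = U \<inter> g -` (- {0})"
  have "open V"
    unfolding V_def using assms(1,3)
    by (intro continuous_open_preimage holomorphic_on_imp_continuous_on) auto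
  show ?thesis
    by (rule analytic_continuation_open[of V U h "\<lambda>_. 0"])
       (use assms \<open>open V\<close> in \<open>auto simp: V_def\<close>)
qed

text \<open>The real points of \<open>U\<close> accumulate at \<open>t\<close>, so the identity
  theorem applies to \<open>g - h\<close>. This compares functions coming from different slices,
  which share their real points.\<close>

lemma identity_theorem_real_axis:
  assumes "open U" "connected U" "g holomorphic_on U" "h holomorphic_on U"
    and t: "complex_of_real t \<in> U"
    and eq: "\<And>x. complex_of_real x \<in> U \<Longrightarrow> g (of_real x) = h (of_real x)" and "z \<in> U"
  shows "g z = h z"
proof -
  obtain e where e: "e > 0" "ball (complex_of_real t) e \<subseteq> U"
    using assms(1) t open_contains_ball by blast
  have "(complex_of_real t) islimpt (of_real ` {x. complex_of_real x \<in> U})"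
    unfolding islimpt_approachable
  proof (intro allI impI)
    fix d :: real assume "d > 0"
    define m where "m = min (d/2) (e/2)"
    have m: "m > 0" "m < d" "m < e"
      using \<open>d > 0\<close> e(1) by (auto simp: m_def)
    have dist: "dist (complex_of_real (t + m)) (of_real t) = m"
      using m(1) by (simp add: dist_norm)
    with m e(2) have "complex_of_real (t + m) \<in> U"
      by (metis dist_commute mem_ball subsetD)
    then show "\<exists>x'\<in>of_real ` {x. complex_of_real x \<in> U}.
        x' \<noteq> complex_of_real t \<and> dist x' (complex_of_real t) < d"
      using m dist by (intro bexI[of _ "complex_of_real (t + m)"] image_eqI[OF refl]) auto
  qed
  then have "(\<lambda>z. g z - h z) z = 0"
    by (rule analytic_continuation[rotated 5])
       (use assms in \<open>auto intro!: holomorphic_intros\<close>)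
  then show ?thesis by simp
qed

text \<open>The Cauchy-Riemann operator multiplies by \<open>J\<close> on the left, so a constant on
  the right does not disturb it. The case \<open>c = 1\<close> treats slice preserving functions; a
  general \<open>c\<close> is needed for the star product.\<close>

lemma slice_regular_of_stem_times_const:
  assumes "open (planar_domain \<Omega>)" and "g holomorphic_on planar_domain \<Omega>"
    and sp: "\<And>J z. J \<in> imag_units \<Longrightarrow> slice_point J z \<in> \<Omega> \<Longrightarrow> z \<in> planar_domain \<Omega>"
    and f: "\<And>J z. \<lbrakk>J \<in> imag_units; z \<in> planar_domain \<Omega>\<rbrakk> \<Longrightarrow> f (slice_point J z) = slice_point J (g z) * c"
  shows "slice_regular \<Omega> f"
  unfolding slice_regular_def
proof (intro ballI allI impI)
  fix J z assume J: "J \<in> imag_units" and "slice_point J z \<in> \<Omega>"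
  then have z: "z \<in> planar_domain \<Omega>" using sp by blast
  obtain g' where g': "(g has_field_derivative g') (at z)"
    using assms(1,2) z by (metis holomorphic_derivI)
  interpret sp: bounded_linear "slice_point J" by (rule bounded_linear_slice_point)
  have "((\<lambda>w. slice_point J (g w) * c) has_derivative (\<lambda>w. slice_point J (g' * w) * c)) (at z)"
    using g' unfolding has_field_derivative_def
    by (intro has_derivative_mult_left sp.has_derivative)
  then have D: "((\<lambda>w. f (slice_point J w)) has_derivative (\<lambda>w. slice_point J (g' * w) * c)) (at z)"
    by (rule has_derivative_transform_within_open[OF _ assms(1) z]) (simp add: f[OF J])
  have "slice_point J \<i> = J" by (simp add: slice_point_def)
  then have "slice_point J (g' * \<i>) = J * slice_point J g'"
    using slice_point_mult[OF J, of \<i> g'] by (simp add: mult.commute)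
  then have "slice_point J (g' * 1) * c + J * (slice_point J (g' * \<i>) * c) =
      slice_point J g' * c + (J * J) * slice_point J g' * c"
    by (simp add: mult.assoc)
  also have "\<dots> = 0" by (simp add: imag_units_square[OF J])
  finally show "\<exists>D. ((\<lambda>w. f (slice_point J w)) has_derivative D) (at z) \<and>
      (1/2) *\<^sub>R (D 1 + J * D \<i>) = 0"
    using D by (intro exI[of _ "\<lambda>w. slice_point J (g' * w) * c"]) simp
qed

section \<open>The planar domain of a symmetric slice domain\<close>

context
  fixes \<Omega> :: "quat set"
  assumes ssd: "symmetric_slice_domain \<Omega>"
begin

lemma slice_point_in_iff:
  assumes "J \<in> imag_units"
  shows "slice_point J z \<in> \<Omega> \<longleftrightarrow> z \<in> planar_domain \<Omega>"
  using ssd assms quat_i_imag_unit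
  unfolding symmetric_slice_domain_def planar_domain_def slice_point_def by blast

text \<open>Conjugating the coordinate amounts to changing the unit \<open>quat_i\<close> to its
  opposite, which symmetry permits.\<close>

lemma cnj_in_planar_domain: "cnj z \<in> planar_domain \<Omega> \<longleftrightarrow> z \<in> planar_domain \<Omega>"
  using slice_point_in_iff[of quat_i "cnj z"] slice_point_in_iff[of "- quat_i" z]
  by (simp add: slice_point_uminus_unit)

lemma slice_coord_in_planar_domain:
  assumes "q \<in> \<Omega>" shows "slice_coord q \<in> planar_domain \<Omega>"
  using assms slice_point_slice_coord[of q] slice_point_in_iff by metis

lemma open_planar_domain: "open (planar_domain \<Omega>)"
proof -
  have "open (slice_point quat_i -` \<Omega>)"
    using ssd bounded_linear.continuous_on[OF bounded_linear_slice_point continuous_on_id]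
    by (intro open_vimage) (auto simp: symmetric_slice_domain_def)
  then show ?thesis by (simp add: planar_domain_def vimage_def)
qed

lemma planar_domain_real:
  obtains t where "complex_of_real t \<in> planar_domain \<Omega>"
proof -
  obtain t where "of_real t \<in> \<Omega>"
    using ssd by (auto simp: symmetric_slice_domain_def Reals_def)
  then show ?thesis using that by (simp add: planar_domain_def)
qed

text \<open>The upper half of the planar domain is a continuous image of \<open>\<Omega>\<close>, and it meets its mirror
  image on the real axis.\<close>

lemma connected_planar_domain: "connected (planar_domain \<Omega>)"
proof -
  define V where "V = slice_coord ` \<Omega>"
  have V: "connected V"
    unfolding V_def using ssd
    by (intro connected_continuous_image continuous_on_slice_coord) (auto simp: symmetric_slice_domain_def)
  have V': "connected (cnj ` V)"
    by (intro connected_continuous_image continuous_intros V)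
  obtain t where t: "complex_of_real t \<in> planar_domain \<Omega>" by (rule planar_domain_real)
  have *: "z \<in> V" if "z \<in> planar_domain \<Omega>" "Im z \<ge> 0" for z
  proof -
    have "slice_coord (slice_point quat_i z) = z"
      using that(2) by (simp add: slice_coord_slice_point)
    then show ?thesis
      using that(1) unfolding V_def planar_domain_def by (metis imageI mem_Collect_eq)
  qed
  have "planar_domain \<Omega> = V \<union> cnj ` V"
  proof (intro equalityI subsetI)
    fix z assume z: "z \<in> planar_domain \<Omega>"
    show "z \<in> V \<union> cnj ` V"
    proof (cases "Im z \<ge> 0")
      case False
      then have "cnj z \<in> V" using z by (intro *) (auto simp: cnj_in_planar_domain)
      then have "cnj (cnj z) \<in> cnj ` V" by blast
      then show ?thesis by simp
    qed (use * z in auto)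
  qed (auto simp: V_def cnj_in_planar_domain slice_coord_in_planar_domain)
  moreover have "complex_of_real t \<in> V \<inter> cnj ` V"
    using *[OF t] by (auto intro: image_eqI[of _ _ "complex_of_real t"])
  ultimately show ?thesis
    using connected_Un[OF V V'] by auto
qed

section \<open>Slice preserving functions correspond to stems\<close>

text \<open>The same quaternion has coordinate \<open>cnj z\<close> for \<open>quat_i\<close> and
  \<open>z\<close> for \<open>- quat_i\<close>; the stem formula is read with both units.\<close>

lemma is_stem_cnj:
  assumes "is_stem \<Omega> f g" "z \<in> planar_domain \<Omega>"
  shows "g (cnj z) = cnj (g z)"
proof -
  have "slice_point quat_i (g (cnj z)) = f (slice_point quat_i (cnj z))"
    using is_stemD(2)[OF assms(1)] assms(2) by (simp add: cnj_in_planar_domain)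
  also have "\<dots> = slice_point (- quat_i) (g z)"
    using is_stemD(2)[OF assms(1), of "- quat_i"] assms(2) by (simp flip: slice_point_uminus_unit)
  finally show ?thesis
    by (metis slice_point_uminus_unit slice_point_inj quat_i_imag_unit)
qed

lemma slice_preserving_of_stem:
  assumes "is_stem \<Omega> f g"
  shows "slice_preserving \<Omega> f"
  unfolding slice_preserving_def
proof (intro conjI ballI subsetI)
  show "slice_regular \<Omega> f"
    using is_stemD[OF assms]
    by (intro slice_regular_of_stem_times_const[where g = g and c = 1])
       (auto simp: open_planar_domain slice_point_in_iff)
  fix J q assume "J \<in> imag_units" "q \<in> f ` (\<Omega> \<inter> slice_plane J)"
  then show "q \<in> slice_plane J"
    using is_stemD(2)[OF assms] by (auto simp: slice_plane_eq slice_point_in_iff)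
qed

text \<open>Each slice \<open>J\<close> yields a holomorphic function \<open>g J\<close>. At real
  points these functions agree, so by the identity theorem they all coincide and
  \<open>g quat_i\<close> is the common stem.\<close>

lemma stem_of_slice_preserving:
  assumes "slice_preserving \<Omega> f"
  obtains g where "is_stem \<Omega> f g"
proof -
  \<comment> \<open>\<open>L J\<close> inverts \<open>slice_point J\<close> on the slice and turns left multiplication by \<open>J\<close> into
    multiplication by \<open>\<i>\<close>, so \<open>L J \<circ> f\<close> inherits the Cauchy-Riemann equation.\<close>
  define L where "L J q = Complex (QRe q) (- QRe (J * q))" for J q
  define g where "g J z = L J (f (slice_point J z))" for J z
  have L_real: "L J (of_real r) = of_real r" if "J \<in> imag_units" for J r
    using that by (simp add: L_def complex_eq_iff imag_units_iff)
  have L_inv: "slice_point J (L J q) = q" if J: "J \<in> imag_units" and q: "q \<in> slice_plane J" for J q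
  proof -
    obtain z where z: "q = slice_point J z" using q by (auto simp: slice_plane_eq)
    have "J * q = of_real (- Im z) + J * of_real (Re z)"
      using imag_units_square[OF J] by (simp add: z slice_point_def distrib_left flip: mult.assoc)
    then have "L J q = z"
      using J by (simp add: L_def z complex_eq_iff imag_units_iff slice_point_def)
    then show ?thesis by (simp add: z)
  qed
  have holo: "g J holomorphic_on planar_domain \<Omega>" if J: "J \<in> imag_units" for J
    unfolding holomorphic_on_open[OF open_planar_domain]
  proof (intro ballI)
    fix z assume z: "z \<in> planar_domain \<Omega>"
    have "slice_regular \<Omega> f" "slice_point J z \<in> \<Omega>"
      using assms J z by (auto simp: slice_preserving_def slice_point_in_iff)
    then obtain D where D: "((\<lambda>w. f (slice_point J w)) has_derivative D) (at z)"
        and "(1/2) *\<^sub>R (D 1 + J * D \<i>) = 0"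
      using J unfolding slice_regular_def by blast
    then have CR: "D 1 + J * D \<i> = 0" by simp
    have bl: "bounded_linear (L J)"
      by (intro linear_conv_bounded_linear[THEN iffD1] linearI)
         (simp_all add: L_def complex_eq_iff algebra_simps)
    have gD: "(g J has_derivative (\<lambda>w. L J (D w))) (at z)"
      unfolding g_def using bounded_linear.has_derivative[OF bl D] .
    interpret DL: linear "\<lambda>w. L J (D w)"
      using has_derivative_linear[OF gD] .
    have "D \<i> = J * D 1"
    proof -
      have "J * (D 1 + J * D \<i>) = J * D 1 + (J * J) * D \<i>"
        by (simp add: distrib_left mult.assoc)
      then show ?thesis using CR imag_units_square[OF J] by simp
    qed
    moreover have "L J (J * q) = \<i> * L J q" for q
    proof -
      have "J * (J * q) = - q" using imag_units_square[OF J] by (simp flip: mult.assoc)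
      then show ?thesis by (simp add: L_def complex_eq_iff)
    qed
    ultimately have Di: "L J (D \<i>) = \<i> * L J (D 1)" by simp
    \<comment> \<open>A real linear map of the plane that commutes with multiplication by
      \<open>\<i>\<close> is multiplication by its value at 1, which is then the complex
      derivative.\<close>
    have "L J (D w) = L J (D 1) * w" for w
    proof -
      have "w = Re w *\<^sub>R 1 + Im w *\<^sub>R \<i>" by (simp add: complex_eq_iff)
      then have "L J (D w) = L J (D (Re w *\<^sub>R 1 + Im w *\<^sub>R \<i>))" by (rule arg_cong)
      also have "\<dots> = Re w *\<^sub>R L J (D 1) + Im w *\<^sub>R L J (D \<i>)"
        unfolding DL.add DL.scaleR ..
      finally show ?thesis by (simp add: Di complex_eq_iff algebra_simps)
    qed
    then have "(\<lambda>w. L J (D w)) = (*) (L J (D 1))" by (rule ext)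
    with gD show "\<exists>f'. (g J has_field_derivative f') (at z)"
      unfolding has_field_derivative_def by (intro exI[of _ "L J (D 1)"]) simp
  qed
  have plane: "f (slice_point J z) \<in> slice_plane J" if "J \<in> imag_units" "z \<in> planar_domain \<Omega>" for J z
  proof -
    have "slice_point J z \<in> \<Omega> \<inter> slice_plane J"
      using that by (simp add: slice_plane_eq slice_point_in_iff)
    then show ?thesis
      using assms that(1) unfolding slice_preserving_def by blast
  qed
  have real: "g J (of_real x) = g quat_i (of_real x)"
    if J: "J \<in> imag_units" and x: "complex_of_real x \<in> planar_domain \<Omega>" for J x
  proof -
    \<comment> \<open>At a real point the value lies in the slices of both \<open>quat_i\<close> and
      \<open>quat_j\<close>, which meet only in the real numbers.\<close>
    obtain z w where "f (of_real x) = slice_point quat_i z" "f (of_real x) = slice_point quat_j w"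
      using plane[OF quat_i_imag_unit x] plane[OF quat_j_imag_unit x] by (auto simp: slice_plane_eq)
    then have "f (of_real x) = of_real (Re z)"
      by (auto simp: slice_point_def quat_eq_iff)
    then show ?thesis by (simp add: g_def L_real J)
  qed
  obtain t where t: "complex_of_real t \<in> planar_domain \<Omega>" by (rule planar_domain_real)
  have "is_stem \<Omega> f (g quat_i)"
    unfolding is_stem_def
  proof (intro conjI ballI holo quat_i_imag_unit)
    fix J z assume J: "J \<in> imag_units" and z: "z \<in> planar_domain \<Omega>"
    have "g J z = g quat_i z"
      by (rule identity_theorem_real_axis[OF open_planar_domain connected_planar_domain
            holo[OF J] holo[OF quat_i_imag_unit] t real[OF J] z])
    then show "f (slice_point J z) = slice_point J (g quat_i z)"
      using L_inv[OF J plane[OF J z]] by (simp add: g_def)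
  qed
  then show ?thesis using that by blast
qed

lemma stem_point:
  assumes "q \<in> \<Omega>"
  obtains J z where "J \<in> imag_units" "z \<in> planar_domain \<Omega>" "q = slice_point J z"
  using slice_point_slice_coord[of q] slice_coord_in_planar_domain[OF assms] by metis

lemma slice_preserving_diff:
  assumes "slice_preserving \<Omega> f" "slice_preserving \<Omega> h"
  shows "slice_preserving \<Omega> (\<lambda>q. f q - h q)"
proof -
  obtain u v where uv: "is_stem \<Omega> f u" "is_stem \<Omega> h v"
    using assms stem_of_slice_preserving by metis
  then have "is_stem \<Omega> (\<lambda>q. f q - h q) (\<lambda>z. u z - v z)"
    by (auto simp: is_stem_def slice_point_diff intro!: holomorphic_intros)
  then show ?thesis by (rule slice_preserving_of_stem)
qed

lemma slice_preserving_mult_of_real: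
  assumes "slice_preserving \<Omega> f"
  shows "slice_preserving \<Omega> (\<lambda>q. f q * of_real r)"
proof -
  obtain u where "is_stem \<Omega> f u"
    using assms stem_of_slice_preserving by metis
  then have "is_stem \<Omega> (\<lambda>q. f q * of_real r) (\<lambda>z. u z * of_real r)"
    by (auto simp: is_stem_def slice_point_mult intro!: holomorphic_intros)
  then show ?thesis by (rule slice_preserving_of_stem)
qed

section \<open>Uniqueness of components and a formula for the star product\<close>

text \<open>Evaluating at a point and at its conjugate in the same slice allows
  \<open>slice_separation\<close> with the zero subspace. Real independence of 1,
  \<open>quat_i\<close>, \<open>quat_j\<close>, \<open>quat_k\<close> then kills all four
  stems.\<close>

lemma ijk_decomposition_zero:
  assumes "ijk_decomposition \<Omega> (\<lambda>_. 0) (\<phi>0, \<phi>1, \<phi>2, \<phi>3)" and q: "q \<in> \<Omega>"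
  shows "\<phi>0 q = 0" "\<phi>1 q = 0" "\<phi>2 q = 0" "\<phi>3 q = 0"
proof -
  obtain u0 u1 u2 u3 where u: "is_stem \<Omega> \<phi>0 u0" "is_stem \<Omega> \<phi>1 u1" "is_stem \<Omega> \<phi>2 u2" "is_stem \<Omega> \<phi>3 u3"
    using assms(1) stem_of_slice_preserving unfolding ijk_decomposition_def by (auto, metis)
  obtain J z where J: "J \<in> imag_units" and z: "z \<in> planar_domain \<Omega>" and q: "q = slice_point J z"
    by (rule stem_point[OF q])
  have z': "cnj z \<in> planar_domain \<Omega>" using z by (simp add: cnj_in_planar_domain)
  have eq: "0 = \<phi>0 (slice_point J w) + \<phi>1 (slice_point J w) * quat_i
      + \<phi>2 (slice_point J w) * quat_j + \<phi>3 (slice_point J w) * quat_k" if "w \<in> planar_domain \<Omega>" for w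
    using assms(1) that J by (auto simp: ijk_decomposition_def slice_point_in_iff)
  have "Re (u0 z) *\<^sub>R 1 + Re (u1 z) *\<^sub>R quat_i + Re (u2 z) *\<^sub>R quat_j + Re (u3 z) *\<^sub>R quat_k \<in> {0}
      \<and> Im (u0 z) *\<^sub>R 1 + Im (u1 z) *\<^sub>R quat_i + Im (u2 z) *\<^sub>R quat_j + Im (u3 z) *\<^sub>R quat_k \<in> {0}"
    by (rule slice_separation[OF J]; insert eq[OF z] eq[OF z'];
        simp add: is_stemD(2)[OF u(1) J] is_stemD(2)[OF u(2) J] is_stemD(2)[OF u(3) J]
          is_stemD(2)[OF u(4) J] z z' u[THEN is_stem_cnj, OF z])
  then have "u0 z = 0 \<and> u1 z = 0 \<and> u2 z = 0 \<and> u3 z = 0"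
    by (simp add: quat_eq_iff complex_eq_iff)
  then show "\<phi>0 q = 0" "\<phi>1 q = 0" "\<phi>2 q = 0" "\<phi>3 q = 0"
    using u[THEN is_stemD(2), OF J z] by (simp_all add: q)
qed

text \<open>The difference of two decompositions of \<open>f\<close> decomposes the zero function,
  so whichever one the choice operator picks agrees with the given one on \<Omega>.\<close>

lemma ijk_components_eq:
  assumes dec: "ijk_decomposition \<Omega> f (\<phi>0, \<phi>1, \<phi>2, \<phi>3)"
  obtains \<psi>0 \<psi>1 \<psi>2 \<psi>3 where "ijk_components \<Omega> f = (\<psi>0, \<psi>1, \<psi>2, \<psi>3)"
    "\<And>q. q \<in> \<Omega> \<Longrightarrow> \<psi>0 q = \<phi>0 q" "\<And>q. q \<in> \<Omega> \<Longrightarrow> \<psi>1 q = \<phi>1 q"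
    "\<And>q. q \<in> \<Omega> \<Longrightarrow> \<psi>2 q = \<phi>2 q" "\<And>q. q \<in> \<Omega> \<Longrightarrow> \<psi>3 q = \<phi>3 q"
proof -
  obtain \<psi>0 \<psi>1 \<psi>2 \<psi>3 where \<psi>: "ijk_components \<Omega> f = (\<psi>0, \<psi>1, \<psi>2, \<psi>3)"
    by (metis prod_cases4)
  have dec': "ijk_decomposition \<Omega> f (\<psi>0, \<psi>1, \<psi>2, \<psi>3)"
    using someI[of "ijk_decomposition \<Omega> f", OF dec] by (simp add: \<psi> flip: ijk_components_def)
  have "ijk_decomposition \<Omega> (\<lambda>_. 0)
      (\<lambda>q. \<psi>0 q - \<phi>0 q, \<lambda>q. \<psi>1 q - \<phi>1 q, \<lambda>q. \<psi>2 q - \<phi>2 q, \<lambda>q. \<psi>3 q - \<phi>3 q)"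
    unfolding ijk_decomposition_def prod.case
  proof (intro conjI ballI)
    fix q assume "q \<in> \<Omega>"
    then have "\<psi>0 q + \<psi>1 q * quat_i + \<psi>2 q * quat_j + \<psi>3 q * quat_k =
        \<phi>0 q + \<phi>1 q * quat_i + \<phi>2 q * quat_j + \<phi>3 q * quat_k"
      using dec dec' by (simp add: ijk_decomposition_def)
    then show "0 = \<psi>0 q - \<phi>0 q + (\<psi>1 q - \<phi>1 q) * quat_i + (\<psi>2 q - \<phi>2 q) * quat_j + (\<psi>3 q - \<phi>3 q) * quat_k"
      by (simp add: algebra_simps)
  qed (use dec dec' in \<open>auto simp: ijk_decomposition_def intro!: slice_preserving_diff\<close>)
  note zero = ijk_decomposition_zero[OF this]
  show ?thesis
    by (rule that[OF \<psi>]) (use zero in auto)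
qed

text \<open>This exhibits a decomposition explicitly, so that \<open>ijk_components\<close> chooses
  from a nonempty set.\<close>

lemma ijk_decomposition_of_unit:
  assumes "slice_preserving \<Omega> f\<^sub>0" "slice_preserving \<Omega> f\<^sub>1" and I: "I \<in> imag_units"
    and f: "\<forall>q\<in>\<Omega>. f q = f\<^sub>0 q + f\<^sub>1 q * I"
  shows "ijk_decomposition \<Omega> f
    (f\<^sub>0, \<lambda>q. f\<^sub>1 q * of_real (QI I), \<lambda>q. f\<^sub>1 q * of_real (QJ I), \<lambda>q. f\<^sub>1 q * of_real (QK I))"
  unfolding ijk_decomposition_def prod.case
proof (intro conjI ballI slice_preserving_mult_of_real assms)
  fix q assume "q \<in> \<Omega>"
  moreover have "I = of_real (QI I) * quat_i + of_real (QJ I) * quat_j + of_real (QK I) * quat_k"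
    using quat_expand[of I] I by (simp add: imag_units_iff)
  then have "f\<^sub>1 q * I = f\<^sub>1 q * (of_real (QI I) * quat_i + of_real (QJ I) * quat_j + of_real (QK I) * quat_k)"
    by simp
  ultimately show "f q = f\<^sub>0 q + f\<^sub>1 q * of_real (QI I) * quat_i + f\<^sub>1 q * of_real (QJ I) * quat_j
      + f\<^sub>1 q * of_real (QK I) * quat_k"
    using f by (simp add: distrib_left mult.assoc add.assoc)
qed

text \<open>The components are \<open>f\<^sub>1\<close> and \<open>h\<^sub>1\<close> times the real
  coordinates of \<open>I\<close> and \<open>J\<close>. Real factors commute with everything, so the
  terms quadratic in these coordinates assemble into the scalar and vector products of
  \<open>I\<close> and \<open>J\<close>.\<close>

lemma star_product_eq:
  assumes "slice_preserving \<Omega> f\<^sub>0" "slice_preserving \<Omega> f\<^sub>1" "I \<in> imag_units" "\<forall>q\<in>\<Omega>. f q = f\<^sub>0 q + f\<^sub>1 q * I"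
    and "slice_preserving \<Omega> h\<^sub>0" "slice_preserving \<Omega> h\<^sub>1" "J \<in> imag_units" "\<forall>q\<in>\<Omega>. h q = h\<^sub>0 q + h\<^sub>1 q * J"
    and q: "q \<in> \<Omega>"
  shows "star_product \<Omega> f h q = f\<^sub>0 q * h\<^sub>0 q - f\<^sub>1 q * h\<^sub>1 q * of_real (inner I J)
    + h\<^sub>0 q * f\<^sub>1 q * I + f\<^sub>0 q * h\<^sub>1 q * J + f\<^sub>1 q * h\<^sub>1 q * quat_wedge I J"
proof -
  have IJ: "QRe I = 0" "QRe J = 0"
    using assms by (auto simp: imag_units_iff)
  obtain \<phi>0 \<phi>1 \<phi>2 \<phi>3 where \<phi>: "ijk_components \<Omega> f = (\<phi>0, \<phi>1, \<phi>2, \<phi>3)"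
    "\<phi>0 q = f\<^sub>0 q" "\<phi>1 q = f\<^sub>1 q * of_real (QI I)" "\<phi>2 q = f\<^sub>1 q * of_real (QJ I)" "\<phi>3 q = f\<^sub>1 q * of_real (QK I)"
    using ijk_components_eq[OF ijk_decomposition_of_unit[OF assms(1-4)]] q by metis
  obtain \<psi>0 \<psi>1 \<psi>2 \<psi>3 where \<psi>: "ijk_components \<Omega> h = (\<psi>0, \<psi>1, \<psi>2, \<psi>3)"
    "\<psi>0 q = h\<^sub>0 q" "\<psi>1 q = h\<^sub>1 q * of_real (QI J)" "\<psi>2 q = h\<^sub>1 q * of_real (QJ J)" "\<psi>3 q = h\<^sub>1 q * of_real (QK J)"
    using ijk_components_eq[OF ijk_decomposition_of_unit[OF assms(5-8)]] q by metis
  define A where "A = f\<^sub>1 q * h\<^sub>1 q"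
  have A: "f\<^sub>1 q * of_real r * (h\<^sub>1 q * of_real s) = A * of_real (r * s)" for r s
    by (simp add: A_def of_real_def mult.commute)
  have vec: "x * of_real (QI P) * quat_i + x * of_real (QJ P) * quat_j + x * of_real (QK P) * quat_k = x * P"
    if "QRe P = 0" for x P
    using that quat_expand[of P] by (metis add_0 distrib_left mult.assoc of_real_0)
  have scal: "A * of_real (QI I * QI J) + A * of_real (QJ I * QJ J) + A * of_real (QK I * QK J)
      = A * of_real (inner I J)"
    using IJ by (simp add: inner_quat_def distrib_left)
  have wedge: "(A * of_real (QJ I * QK J) - A * of_real (QK I * QJ J)) * quat_i
      + (A * of_real (QK I * QI J) - A * of_real (QI I * QK J)) * quat_j
      + (A * of_real (QI I * QJ J) - A * of_real (QJ I * QI J)) * quat_k = A * quat_wedge I J"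
    using vec[of "quat_wedge I J" A] by (simp only: quat_wedge_sel of_real_diff right_diff_distrib)
  have "star_product \<Omega> f h q = f\<^sub>0 q * h\<^sub>0 q
      - (A * of_real (QI I * QI J) + A * of_real (QJ I * QJ J) + A * of_real (QK I * QK J))
      + f\<^sub>0 q * (h\<^sub>1 q * of_real (QI J) * quat_i + h\<^sub>1 q * of_real (QJ J) * quat_j + h\<^sub>1 q * of_real (QK J) * quat_k)
      + h\<^sub>0 q * (f\<^sub>1 q * of_real (QI I) * quat_i + f\<^sub>1 q * of_real (QJ I) * quat_j + f\<^sub>1 q * of_real (QK I) * quat_k)
      + ((A * of_real (QJ I * QK J) - A * of_real (QK I * QJ J)) * quat_i
      + (A * of_real (QK I * QI J) - A * of_real (QI I * QK J)) * quat_j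
      + (A * of_real (QI I * QJ J) - A * of_real (QJ I * QI J)) * quat_k)"
    by (simp only: star_product_def \<phi> \<psi> prod.case A diff_diff_add add.assoc mult.commute[of "_ :: real"])
  then show ?thesis
    unfolding scal wedge vec[OF IJ(1)] vec[OF IJ(2)] by (simp add: A_def mult.assoc algebra_simps)
qed

end

section \<open>Star products that preserve a given slice\<close>

theorem theorem4p3:
  fixes \<Omega> :: "quat set"
    and I\<^sub>0 J\<^sub>0 K\<^sub>0 :: quat
    and f h f\<^sub>0 f\<^sub>1 h\<^sub>0 h\<^sub>1 :: "quat \<Rightarrow> quat"
  assumes "symmetric_slice_domain \<Omega>"
    and "I\<^sub>0 \<in> imag_units" and "J\<^sub>0 \<in> imag_units"
    and "I\<^sub>0 \<noteq> J\<^sub>0" and "independent {I\<^sub>0, J\<^sub>0}"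
    and "slice_regular \<Omega> f" and "slice_regular \<Omega> h"
    and "\<not> slice_preserving \<Omega> f" and "\<not> slice_preserving \<Omega> h"
    and "plane_preserving \<Omega> I\<^sub>0 f" and "plane_preserving \<Omega> J\<^sub>0 h"
    and "slice_preserving \<Omega> f\<^sub>0" and "slice_preserving \<Omega> f\<^sub>1"
    and "slice_preserving \<Omega> h\<^sub>0" and "slice_preserving \<Omega> h\<^sub>1"
    and "\<forall>q\<in>\<Omega>. f q = f\<^sub>0 q + f\<^sub>1 q * I\<^sub>0"
    and "\<forall>q\<in>\<Omega>. h q = h\<^sub>0 q + h\<^sub>1 q * J\<^sub>0"
    and "K\<^sub>0 \<in> imag_units"
  shows "plane_preserving \<Omega> K\<^sub>0 (star_product \<Omega> f h) \<longleftrightarrow>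
    (\<exists>a b \<epsilon> :: real. \<epsilon> \<noteq> 0 \<and>
       K\<^sub>0 = a *\<^sub>R I\<^sub>0 + b *\<^sub>R J\<^sub>0 + \<epsilon> *\<^sub>R quat_wedge I\<^sub>0 J\<^sub>0 \<and>
       (\<forall>q\<in>\<Omega>. f q = f\<^sub>1 q * (of_real (b / \<epsilon>) + I\<^sub>0)) \<and>
       (\<forall>q\<in>\<Omega>. h q = h\<^sub>1 q * (of_real (a / \<epsilon>) + J\<^sub>0)))"
proof -
  note ssd = assms(1)
  let ?U = "planar_domain \<Omega>" and ?N = "quat_wedge I\<^sub>0 J\<^sub>0"
  note U = open_planar_domain[OF ssd] connected_planar_domain[OF ssd]
  obtain p0 p1 r0 r1 where p0: "is_stem \<Omega> f\<^sub>0 p0" and p1: "is_stem \<Omega> f\<^sub>1 p1"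
      and r0: "is_stem \<Omega> h\<^sub>0 r0" and r1: "is_stem \<Omega> h\<^sub>1 r1"
    using assms(12-15) stem_of_slice_preserving[OF ssd] by metis
  note holo = p0[THEN is_stemD(1)] p1[THEN is_stemD(1)] r0[THEN is_stemD(1)] r1[THEN is_stemD(1)]
  note val = p0[THEN is_stemD(2)] p1[THEN is_stemD(2)] r0[THEN is_stemD(2)] r1[THEN is_stemD(2)]
  \<comment> \<open>Both values lie in one common slice, where multiplication is
    commutative.\<close>
  have commute: "f\<^sub>1 q * h\<^sub>1 q = h\<^sub>1 q * f\<^sub>1 q" if "q \<in> \<Omega>" for q
    using that stem_point[OF ssd that] val by (metis slice_point_mult mult.commute)
  note star = star_product_eq[OF ssd assms(12,13,2,16) assms(14,15,3,17)]
  show ?thesis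
  proof
    assume "\<exists>a b \<epsilon> :: real. \<epsilon> \<noteq> 0 \<and>
       K\<^sub>0 = a *\<^sub>R I\<^sub>0 + b *\<^sub>R J\<^sub>0 + \<epsilon> *\<^sub>R quat_wedge I\<^sub>0 J\<^sub>0 \<and>
       (\<forall>q\<in>\<Omega>. f q = f\<^sub>1 q * (of_real (b / \<epsilon>) + I\<^sub>0)) \<and>
       (\<forall>q\<in>\<Omega>. h q = h\<^sub>1 q * (of_real (a / \<epsilon>) + J\<^sub>0))"
    then obtain a b \<epsilon> :: real where \<epsilon>: "\<epsilon> \<noteq> 0" and K: "K\<^sub>0 = a *\<^sub>R I\<^sub>0 + b *\<^sub>R J\<^sub>0 + \<epsilon> *\<^sub>R ?N"
      and f: "\<forall>q\<in>\<Omega>. f q = f\<^sub>1 q * (of_real (b / \<epsilon>) + I\<^sub>0)"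
      and h: "\<forall>q\<in>\<Omega>. h q = h\<^sub>1 q * (of_real (a / \<epsilon>) + J\<^sub>0)"
      by blast
    \<comment> \<open>Here \<open>f\<^sub>0\<close> is \<open>b / \<epsilon>\<close> times
      \<open>f\<^sub>1\<close> and \<open>h\<^sub>0\<close> is \<open>a / \<epsilon>\<close> times
      \<open>h\<^sub>1\<close>. After the factor \<open>f\<^sub>1 q * h\<^sub>1 q\<close> is taken
      out of the star product, \<open>c\<close> is the real part that remains, and the imaginary
      part is \<open>K\<^sub>0\<close> divided by \<epsilon>.\<close>
    define c where "c = a * b / \<epsilon>\<^sup>2 - inner I\<^sub>0 J\<^sub>0"
    have K': "of_real c + (1 / \<epsilon>) *\<^sub>R K\<^sub>0 = slice_point K\<^sub>0 (Complex c (1 / \<epsilon>))"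
      by (simp only: slice_point_def complex.sel) (simp add: of_real_def)
    have eq: "star_product \<Omega> f h q = f\<^sub>1 q * h\<^sub>1 q * (of_real c + (1 / \<epsilon>) *\<^sub>R K\<^sub>0)" if q: "q \<in> \<Omega>" for q
    proof -
      define A u v where "A = f\<^sub>1 q * h\<^sub>1 q" and "u = a / \<epsilon>" and "v = b / \<epsilon>"
      have "f\<^sub>1 q * (of_real v + I\<^sub>0) = f\<^sub>0 q + f\<^sub>1 q * I\<^sub>0" "h\<^sub>1 q * (of_real u + J\<^sub>0) = h\<^sub>0 q + h\<^sub>1 q * J\<^sub>0"
        using f h assms(16,17) q by (simp_all add: u_def v_def)
      then have f0: "f\<^sub>0 q = v *\<^sub>R f\<^sub>1 q" and h0: "h\<^sub>0 q = u *\<^sub>R h\<^sub>1 q"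
        by (simp_all add: distrib_left of_real_def)
      have K'': "(1 / \<epsilon>) *\<^sub>R K\<^sub>0 = u *\<^sub>R I\<^sub>0 + v *\<^sub>R J\<^sub>0 + ?N"
        using \<epsilon> by (simp add: K scaleR_add_right u_def v_def)
      have c: "of_real c = (v * u - inner I\<^sub>0 J\<^sub>0) *\<^sub>R (1 :: quat)"
        unfolding of_real_def by (simp add: c_def u_def v_def power2_eq_square mult.commute)
      have "star_product \<Omega> f h q = (v * u) *\<^sub>R A - inner I\<^sub>0 J\<^sub>0 *\<^sub>R A
          + u *\<^sub>R (A * I\<^sub>0) + v *\<^sub>R (A * J\<^sub>0) + A * ?N"
        unfolding star[OF q] f0 h0 A_def using commute[OF q] by (simp add: of_real_def)
      also have "\<dots> = A * (of_real c + (1 / \<epsilon>) *\<^sub>R K\<^sub>0)"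
        unfolding K'' c by (simp add: distrib_left right_diff_distrib scaleR_diff_left add.assoc)
      finally show ?thesis by (simp only: A_def)
    qed
    show "plane_preserving \<Omega> K\<^sub>0 (star_product \<Omega> f h)"
      unfolding plane_preserving_def
    proof (intro conjI subsetI)
      show "slice_regular \<Omega> (star_product \<Omega> f h)"
      proof (rule slice_regular_of_stem_times_const[OF U(1)])
        show "(\<lambda>z. p1 z * r1 z) holomorphic_on ?U"
          by (intro holomorphic_intros holo)
        fix J z assume J: "J \<in> imag_units"
        show "slice_point J z \<in> \<Omega> \<Longrightarrow> z \<in> ?U"
          using J by (simp add: slice_point_in_iff[OF ssd])
        assume "z \<in> ?U"
        then show "star_product \<Omega> f h (slice_point J z) =
            slice_point J (p1 z * r1 z) * (of_real c + (1 / \<epsilon>) *\<^sub>R K\<^sub>0)"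
          using J by (simp add: eq slice_point_in_iff[OF ssd] val slice_point_mult)
      qed
      fix x assume "x \<in> star_product \<Omega> f h ` (\<Omega> \<inter> slice_plane K\<^sub>0)"
      then obtain z where z: "slice_point K\<^sub>0 z \<in> \<Omega>" and x: "x = star_product \<Omega> f h (slice_point K\<^sub>0 z)"
        by (auto simp: slice_plane_eq)
      have "x = slice_point K\<^sub>0 (p1 z * r1 z * Complex c (1 / \<epsilon>))"
        using z assms(18) unfolding x
        by (simp add: eq K' slice_point_in_iff[OF ssd] val slice_point_mult)
      then show "x \<in> slice_plane K\<^sub>0" by (simp add: slice_plane_eq)
    qed
  next
    assume pp: "plane_preserving \<Omega> K\<^sub>0 (star_product \<Omega> f h)"
    let ?P = "slice_plane K\<^sub>0"
    \<comment> \<open>These are the stems of the coefficients of \<open>I\<^sub>0\<close>,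
      \<open>J\<^sub>0\<close> and \<open>?N\<close> in the star product; \<open>D\<close> below is
      the stem of the remaining slice preserving term.\<close>
    define A B C where "A z = r0 z * p1 z" and "B z = p0 z * r1 z" and "C z = p1 z * r1 z" for z
    define D where "D z = p0 z * r0 z - p1 z * r1 z * of_real (inner I\<^sub>0 J\<^sub>0)" for z
    note stems = A_def B_def C_def D_def
    have P: "subspace ?P" "1 \<in> ?P" "\<And>x. x \<in> ?P \<Longrightarrow> K\<^sub>0 * x \<in> ?P"
    proof -
      show "subspace ?P" "1 \<in> ?P"
        by (auto simp: slice_plane_def span_base)
      have "K\<^sub>0 = slice_point K\<^sub>0 \<i>" by (simp add: slice_point_def)
      then show "K\<^sub>0 * x \<in> ?P" if "x \<in> ?P" for x
        using that slice_point_mult[OF assms(18), of \<i>, symmetric] by (auto simp: slice_plane_eq)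
    qed
    have in_plane: "slice_point K\<^sub>0 (D z) * 1 + slice_point K\<^sub>0 (A z) * I\<^sub>0 + slice_point K\<^sub>0 (B z) * J\<^sub>0
        + slice_point K\<^sub>0 (C z) * ?N \<in> ?P" if z: "z \<in> ?U" for z
    proof -
      have q: "slice_point K\<^sub>0 z \<in> \<Omega>" using z assms(18) by (simp add: slice_point_in_iff[OF ssd])
      then have "star_product \<Omega> f h (slice_point K\<^sub>0 z) \<in> ?P"
        using pp by (auto simp: plane_preserving_def slice_plane_eq)
      then show ?thesis
        unfolding star[OF q] using z assms(18)
        by (simp add: stems val slice_point_mult slice_point_diff)
    qed
    have line: "(\<exists>t. Re (A z) *\<^sub>R I\<^sub>0 + Re (B z) *\<^sub>R J\<^sub>0 + Re (C z) *\<^sub>R ?N = t *\<^sub>R K\<^sub>0) \<and>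
        (\<exists>t. Im (A z) *\<^sub>R I\<^sub>0 + Im (B z) *\<^sub>R J\<^sub>0 + Im (C z) *\<^sub>R ?N = t *\<^sub>R K\<^sub>0)" if z: "z \<in> ?U" for z
    proof -
      have z': "cnj z \<in> ?U" using z by (simp add: cnj_in_planar_domain[OF ssd])
      have "D (cnj z) = cnj (D z)" "A (cnj z) = cnj (A z)" "B (cnj z) = cnj (B z)" "C (cnj z) = cnj (C z)"
        by (simp_all add: stems p0[THEN is_stem_cnj[OF ssd], OF z] p1[THEN is_stem_cnj[OF ssd], OF z]
          r0[THEN is_stem_cnj[OF ssd], OF z] r1[THEN is_stem_cnj[OF ssd], OF z])
      note sep = slice_separation[OF assms(18) P(1) P(3) in_plane[OF z] in_plane[OF z', unfolded this]]
      \<comment> \<open>The plane contains 1, so the real term may be subtracted; what is left is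
        purely imaginary, hence a real multiple of \<open>K\<^sub>0\<close>.\<close>
      have drop: "\<exists>t. y *\<^sub>R I\<^sub>0 + v *\<^sub>R J\<^sub>0 + w *\<^sub>R ?N = t *\<^sub>R K\<^sub>0"
        if "x *\<^sub>R 1 + y *\<^sub>R I\<^sub>0 + v *\<^sub>R J\<^sub>0 + w *\<^sub>R ?N \<in> ?P" for x y v w
      proof -
        have "(x *\<^sub>R 1 + y *\<^sub>R I\<^sub>0 + v *\<^sub>R J\<^sub>0 + w *\<^sub>R ?N) - x *\<^sub>R 1 \<in> ?P"
          by (intro subspace_diff subspace_scale P that)
        then have "y *\<^sub>R I\<^sub>0 + v *\<^sub>R J\<^sub>0 + w *\<^sub>R ?N \<in> ?P" by (simp add: algebra_simps)
        moreover have "QRe (y *\<^sub>R I\<^sub>0 + v *\<^sub>R J\<^sub>0 + w *\<^sub>R ?N) = 0"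
          using assms(2,3) by (simp add: imag_units_iff quat_wedge_sel)
        ultimately show ?thesis using slice_plane_imaginary[OF assms(18)] by metis
      qed
      show ?thesis using sep drop by blast
    qed
    have cancel_p1: "g z = 0"
      if "g holomorphic_on ?U" "\<And>z. z \<in> ?U \<Longrightarrow> p1 z * g z = 0" "z \<in> ?U" for g z
    proof -
      \<comment> \<open>If \<open>p1\<close> vanished identically, \<open>f\<close> would equal
        \<open>f\<^sub>0\<close> on \<Omega> and be slice preserving.\<close>
      have "\<exists>w\<in>?U. p1 w \<noteq> 0"
      proof (rule ccontr)
        assume "\<not> (\<exists>w\<in>?U. p1 w \<noteq> 0)"
        then have "is_stem \<Omega> f p0"
          using p0 val(2) assms(16) by (auto simp: is_stem_def slice_point_in_iff[OF ssd])
        then show False using assms(8) slice_preserving_of_stem[OF ssd] by blast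
      qed
      then show ?thesis using identity_theorem_mult[OF U holo(2) that(1,2)] that(3) by blast
    qed
    have cancel_r1: "g z = 0"
      if "g holomorphic_on ?U" "\<And>z. z \<in> ?U \<Longrightarrow> r1 z * g z = 0" "z \<in> ?U" for g z
    proof -
      have "\<exists>w\<in>?U. r1 w \<noteq> 0"
      proof (rule ccontr)
        assume "\<not> (\<exists>w\<in>?U. r1 w \<noteq> 0)"
        then have "is_stem \<Omega> h r0"
          using r0 val(4) assms(17) by (auto simp: is_stem_def slice_point_in_iff[OF ssd])
        then show False using assms(9) slice_preserving_of_stem[OF ssd] by blast
      qed
      then show ?thesis using identity_theorem_mult[OF U holo(4) that(1,2)] that(3) by blast
    qed
    have "\<exists>z\<in>?U. C z \<noteq> 0"
    proof (rule ccontr)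
      assume "\<not> (\<exists>z\<in>?U. C z \<noteq> 0)"
      then have C0: "p1 z * r1 z = 0" if "z \<in> ?U" for z using that by (simp add: C_def)
      obtain t where t: "complex_of_real t \<in> ?U" by (rule planar_domain_real[OF ssd])
      have "r1 z = 0" if "z \<in> ?U" for z by (rule cancel_p1[OF holo(4) C0 that])
      \<comment> \<open>Cancelling the identically zero \<open>r1\<close> from its product with the
        constant 1 yields the absurdity.\<close>
      then have "(1::complex) = 0"
        by (intro cancel_r1[of "\<lambda>_. 1", OF _ _ t]) auto
      then show False by simp
    qed
    then obtain z0 where z0: "z0 \<in> ?U" "C z0 \<noteq> 0" by blast
    \<comment> \<open>Either the real or the imaginary part of \<open>C z0\<close> is nonzero; that
      part is \<open>w\<close>, and dividing its relation by \<open>t\<close> gives the coordinates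
      of \<open>K\<^sub>0\<close>.\<close>
    obtain x y w t where w: "w \<noteq> 0" and xyw: "x *\<^sub>R I\<^sub>0 + y *\<^sub>R J\<^sub>0 + w *\<^sub>R ?N = t *\<^sub>R K\<^sub>0"
      using line[OF z0(1)] z0(2) by (metis complex_eq_iff zero_complex.simps)
    note indep = independent_wedge_scaleR[OF assms(2,3,5,4)]
    have t: "t \<noteq> 0" using indep[of x y w] xyw w by auto
    define a b \<epsilon> where "a = x / t" and "b = y / t" and "\<epsilon> = w / t"
    have \<epsilon>: "\<epsilon> \<noteq> 0" using w t by (simp add: \<epsilon>_def)
    have K: "K\<^sub>0 = a *\<^sub>R I\<^sub>0 + b *\<^sub>R J\<^sub>0 + \<epsilon> *\<^sub>R ?N"
    proof -
      have "K\<^sub>0 = (1 / t) *\<^sub>R (t *\<^sub>R K\<^sub>0)" using t by simp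
      also have "\<dots> = a *\<^sub>R I\<^sub>0 + b *\<^sub>R J\<^sub>0 + \<epsilon> *\<^sub>R ?N"
        unfolding xyw[symmetric] by (simp add: scaleR_add_right a_def b_def \<epsilon>_def)
      finally show ?thesis .
    qed
    \<comment> \<open>Coordinates of a multiple of \<open>K\<^sub>0\<close> are proportional to
      \<open>a\<close>, \<open>b\<close>, \<epsilon>. As \<open>a / \<epsilon>\<close> and
      \<open>b / \<epsilon>\<close> are real, the relations for real and imaginary parts combine
      into the complex equations \<open>AB\<close>.\<close>
    have coords: "u = a / \<epsilon> * w \<and> v = b / \<epsilon> * w"
      if "\<exists>t. u *\<^sub>R I\<^sub>0 + v *\<^sub>R J\<^sub>0 + w *\<^sub>R ?N = t *\<^sub>R K\<^sub>0" for u v w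
    proof -
      from that obtain t where "u *\<^sub>R I\<^sub>0 + v *\<^sub>R J\<^sub>0 + w *\<^sub>R ?N = t *\<^sub>R K\<^sub>0" ..
      then have "(u - t * a) *\<^sub>R I\<^sub>0 + (v - t * b) *\<^sub>R J\<^sub>0 + (w - t * \<epsilon>) *\<^sub>R ?N = 0"
        by (subst (asm) K) (simp add: algebra_simps)
      from indep[OF this] show ?thesis using \<epsilon> by (simp add: field_simps)
    qed
    have AB: "A z = of_real (a / \<epsilon>) * C z" "B z = of_real (b / \<epsilon>) * C z" if "z \<in> ?U" for z
      using line[OF that, THEN conjunct1, THEN coords] line[OF that, THEN conjunct2, THEN coords]
      unfolding complex_eq_iff times_complex.simps by (simp_all del: of_real_divide)
    \<comment> \<open>The equation for \<open>A\<close> says that \<open>p1\<close> times this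
      function is zero. Below, the equation for \<open>B\<close> is used likewise, with
      \<open>r1\<close> as the factor to cancel.\<close>
    have "(\<lambda>z. r0 z - of_real (a / \<epsilon>) * r1 z) z = 0" if "z \<in> ?U" for z
      by (rule cancel_p1[OF _ _ that]; (intro holomorphic_intros holo)?)
         (use AB(1) in \<open>simp add: A_def C_def algebra_simps\<close>)
    then have r: "r0 z = r1 z * of_real (a / \<epsilon>)" if "z \<in> ?U" for z
      using that by (simp add: mult.commute)
    have "(\<lambda>z. p0 z - of_real (b / \<epsilon>) * p1 z) z = 0" if "z \<in> ?U" for z
      by (rule cancel_r1[OF _ _ that]; (intro holomorphic_intros holo)?)
         (use AB(2) in \<open>simp add: B_def C_def algebra_simps\<close>)
    then have p: "p0 z = p1 z * of_real (b / \<epsilon>)" if "z \<in> ?U" for z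
      using that by (simp add: mult.commute)
    have "f q = f\<^sub>1 q * (of_real (b / \<epsilon>) + I\<^sub>0) \<and> h q = h\<^sub>1 q * (of_real (a / \<epsilon>) + J\<^sub>0)" if q: "q \<in> \<Omega>" for q
    proof -
      obtain J z where J: "J \<in> imag_units" and z: "z \<in> ?U" and q': "q = slice_point J z"
        by (rule stem_point[OF ssd q])
      have "f\<^sub>0 q = f\<^sub>1 q * of_real (b / \<epsilon>)" "h\<^sub>0 q = h\<^sub>1 q * of_real (a / \<epsilon>)"
        unfolding q' val(1)[OF J z] val(2)[OF J z] val(3)[OF J z] val(4)[OF J z] p[OF z] r[OF z]
        by (simp_all only: slice_point_mult[OF J] slice_point_of_real)
      then show ?thesis using assms(16,17) q by (simp add: distrib_left)
    qed
    with \<epsilon> K show "\<exists>a b \<epsilon> :: real. \<epsilon> \<noteq> 0 \<and>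
       K\<^sub>0 = a *\<^sub>R I\<^sub>0 + b *\<^sub>R J\<^sub>0 + \<epsilon> *\<^sub>R quat_wedge I\<^sub>0 J\<^sub>0 \<and>
       (\<forall>q\<in>\<Omega>. f q = f\<^sub>1 q * (of_real (b / \<epsilon>) + I\<^sub>0)) \<and>
       (\<forall>q\<in>\<Omega>. h q = h\<^sub>1 q * (of_real (a / \<epsilon>) + J\<^sub>0))"
      by blast
  qed
qed

end
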